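(* Let $\mathfrak b$ be the Boolean $C^*$-algebra on $\ell^2(\{\#\}\cup\mathbb Z)$. For its fixed point subalgebras $\mathfrak b^{\mathbb P_{\mathbb Z}}$ and $\mathfrak b^{\mathbb Z}$ under the permutations and the shift, respectively, one has $$\mathfrak b^{\mathbb P_{\mathbb Z}}=\mathfrak b^{\mathbb Z}=\mathbb CP_\#\oplus\mathbb CP_\#^\perp,$$ where $P_\#=a_ia_i^\dagger$ (for each $i\in\mathbb Z$) is the orthogonal projection onto the linear span of $e_\#$.
   Context: The Boolean Fock space over $\ell^2(\mathbb Z)$ is $\mathbb C\oplus\ell^2(\mathbb Z)=\ell^2(\{\#\}\cup\mathbb Z)$, with canonical basis $\{e_j\mid j\in\{\#\}\cup\mathbb Z\}$ and vacuum $\Omega=e_\#$. For $i\in\mathbb Z$, $a_i^\dagger(c\oplus g)=0\oplus c\,e_i$ and $a_i(c\oplus g)=\langle g,e_i\rangle\oplus0$. The Boolean $C^*$-algebra $\mathfrak b$ is the unital $C^*$-algebra generated by $\{a_i\mid i\in\mathbb Z\}$; it equals $\mathcal K(\ell^2(\{\#\}\cup\mathbb Z))+\mathbb CI$, with $\mathcal K$ the compact operators. $\mathbb P_{\mathbb Z}$ is the group of permutations of $\mathbb Z$ moving only finitely many elements; it acts on $\mathfrak b$ by the automorphisms $\beta_g$ with $\beta_g(a_i)=a_{g(i)}$, and the shift is the automorphism $\alpha$ with $\alpha(a_i)=a_{i+1}$ (implemented by the unitaries fixing $e_\#$ and sending $e_i$ to $e_{g(i)}$, resp. $e_{i+1}$).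 $\mathfrak b^{\mathbb P_{\mathbb Z}}=\{A\in\mathfrak b\mid\beta_g(A)=A\ \forall g\in\mathbb P_{\mathbb Z}\}$, $\mathfrak b^{\mathbb Z}=\{A\in\mathfrak b\mid\alpha(A)=A\}$, and $P_\#^\perp=I-P_\#$. *)

theory Defs
  imports "HOL-Analysis.Analysis"
begin

section \<open>The complex Hilbert space of square-summable families\<close>

typedef 'a ell2 = "{f :: 'a \<Rightarrow> complex. (\<lambda>j. (cmod (f j))\<^sup>2) summable_on UNIV}"
  morphisms coord Abs_ell2
  by (rule exI[of _ "\<lambda>_. 0"]) simp

setup_lifting type_definition_ell2

lemma ell2_eqI: "(\<And>j. coord x j = coord y j) \<Longrightarrow> x = y"
  by (metis coord_inject ext)

lemma coord_summable: "(\<lambda>j. (cmod (coord x j))\<^sup>2) summable_on UNIV"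
  using coord[of x] by simp

lemma abs_summable_mult_ell2:
  fixes f g :: "'a \<Rightarrow> complex"
  assumes "(\<lambda>j. (cmod (f j))\<^sup>2) summable_on UNIV" "(\<lambda>j. (cmod (g j))\<^sup>2) summable_on UNIV"
  shows "(\<lambda>j. cmod (f j * cnj (g j))) summable_on UNIV"
proof -
  have "(\<lambda>j. cmod (f j * f j)) summable_on UNIV" "(\<lambda>j. cmod (cnj (g j) * cnj (g j))) summable_on UNIV"
    using assms by (simp_all add: norm_mult power2_eq_square)
  then show ?thesis by (rule Infinite_Sum.abs_summable_product)
qed

lemma square_summable_add:
  fixes f g :: "'a \<Rightarrow> complex"
  assumes f: "(\<lambda>j. (cmod (f j))\<^sup>2) summable_on UNIV" and g: "(\<lambda>j. (cmod (g j))\<^sup>2) summable_on UNIV"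
  shows "(\<lambda>j. (cmod (f j + g j))\<^sup>2) summable_on UNIV"
proof (rule summable_on_comparison_test)
  show "(\<lambda>j. 2 * (cmod (f j))\<^sup>2 + 2 * (cmod (g j))\<^sup>2) summable_on UNIV"
    using f g by (intro summable_on_add summable_on_cmult_right)
  fix j
  have "(cmod (f j + g j))\<^sup>2 \<le> (cmod (f j) + cmod (g j))\<^sup>2"
    by (intro power_mono norm_triangle_ineq) auto
  also have "\<dots> \<le> 2 * (cmod (f j))\<^sup>2 + 2 * (cmod (g j))\<^sup>2"
    using zero_le_power2[of "cmod (f j) - cmod (g j)"] by (simp add: power2_eq_square algebra_simps)
  finally show "(cmod (f j + g j))\<^sup>2 \<le> 2 * (cmod (f j))\<^sup>2 + 2 * (cmod (g j))\<^sup>2" .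
qed auto

lemma square_summable_scale:
  fixes f :: "'a \<Rightarrow> complex"
  assumes "(\<lambda>j. (cmod (f j))\<^sup>2) summable_on UNIV"
  shows "(\<lambda>j. (cmod (c * f j))\<^sup>2) summable_on UNIV"
  using assms by (simp add: norm_mult power_mult_distrib summable_on_cmult_right)

lift_definition cscale :: "complex \<Rightarrow> 'a ell2 \<Rightarrow> 'a ell2" (infixr "*\<^sub>c" 75)
  is "\<lambda>c f j. c * f j"
  by (simp add: square_summable_scale)

text \<open>The inner product is linear in the first argument.\<close>

definition cinner :: "'a ell2 \<Rightarrow> 'a ell2 \<Rightarrow> complex"
  where "cinner x y = (\<Sum>\<^sub>\<infinity>j. coord x j * cnj (coord y j))"

lemma cinner_summable: "(\<lambda>j. coord x j * cnj (coord y j)) summable_on UNIV"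
  by (rule Infinite_Sum.abs_summable_summable[OF abs_summable_mult_ell2[OF coord_summable coord_summable]])

instantiation ell2 :: (type) real_vector
begin

lift_definition zero_ell2 :: "'a ell2" is "\<lambda>_. 0" by simp
lift_definition plus_ell2 :: "'a ell2 \<Rightarrow> 'a ell2 \<Rightarrow> 'a ell2" is "\<lambda>f g j. f j + g j"
  by (simp add: square_summable_add)
lift_definition uminus_ell2 :: "'a ell2 \<Rightarrow> 'a ell2" is "\<lambda>f j. - f j" by simp
definition "x - y = x + (- y :: 'a ell2)"
definition "r *\<^sub>R x = complex_of_real r *\<^sub>c (x :: 'a ell2)"

lemmas coord_simps =
  zero_ell2.rep_eq plus_ell2.rep_eq uminus_ell2.rep_eq cscale.rep_eq

instance
  by standard
    (rule ell2_eqI, simp add: minus_ell2_def scaleR_ell2_def coord_simps algebra_simps)+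

end

lemma coord_zero [simp]: "coord 0 j = 0"
  and coord_add [simp]: "coord (x + y) j = coord x j + coord y j"
  and coord_uminus [simp]: "coord (- x) j = - coord x j"
  and coord_diff [simp]: "coord (x - y) j = coord x j - coord y j"
  and coord_cscale [simp]: "coord (c *\<^sub>c x) j = c * coord x j"
  and coord_scaleR [simp]: "coord (r *\<^sub>R x) j = complex_of_real r * coord x j"
  by (simp_all only: coord_simps minus_ell2_def scaleR_ell2_def diff_conv_add_uminus)

lemma cinner_commute: "cinner y x = cnj (cinner x y)"
  unfolding cinner_def by (subst infsum_cnj[symmetric]) (simp add: mult.commute)

lemma cinner_add_left: "cinner (x + y) z = cinner x z + cinner y z"
  unfolding cinner_def by (simp add: distrib_right infsum_add cinner_summable)

lemma cinner_cscale_left: "cinner (c *\<^sub>c x) y = c * cinner x y"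
  unfolding cinner_def by (simp add: mult.assoc infsum_cmult_right')

lemma cinner_cscale_right: "cinner x (c *\<^sub>c y) = cnj c * cinner x y"
  by (metis cinner_commute cinner_cscale_left complex_cnj_mult)

lemma Re_cinner_self: "Re (cinner x x) = (\<Sum>\<^sub>\<infinity>j. (cmod (coord x j))\<^sup>2)"
proof -
  have "cinner x x = (\<Sum>\<^sub>\<infinity>j. complex_of_real ((cmod (coord x j))\<^sup>2))"
    by (simp only: cinner_def complex_norm_square)
  also have "\<dots> = complex_of_real (\<Sum>\<^sub>\<infinity>j. (cmod (coord x j))\<^sup>2)"
    by (intro infsumI has_sum_of_real has_sum_infsum coord_summable)
  finally show ?thesis by simp
qed

text \<open>The real inner product is the real part of the complex one and induces the same norm.\<close>

instantiation ell2 :: (type) real_inner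
begin

definition "inner x y = Re (cinner x (y :: 'a ell2))"
definition "norm x = sqrt (Re (cinner x (x :: 'a ell2)))"
definition "sgn x = x /\<^sub>R norm (x :: 'a ell2)"
definition "dist x y = norm (x - y :: 'a ell2)"
definition "(uniformity :: ('a ell2 \<times> 'a ell2) filter) = (INF e\<in>{0<..}. principal {(x, y). dist x y < e})"
definition "open (U :: 'a ell2 set) = (\<forall>x\<in>U. \<forall>\<^sub>F (x', y) in uniformity. x' = x \<longrightarrow> y \<in> U)"

instance
proof
  fix x y z :: "'a ell2" and r :: real
  show "dist x y = norm (x - y)" "sgn x = x /\<^sub>R norm x" "norm x = sqrt (inner x x)"
    by (simp_all add: dist_ell2_def sgn_ell2_def norm_ell2_def inner_ell2_def)
  show "uniformity = (INF e\<in>{0<..}. principal {(x, y::'a ell2). dist x y < e})"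
    by (rule uniformity_ell2_def)
  show "open U = (\<forall>x\<in>U. \<forall>\<^sub>F (x', y) in uniformity. x' = x \<longrightarrow> y \<in> U)" for U :: "'a ell2 set"
    by (rule open_ell2_def)
  show "inner x y = inner y x"
    by (simp add: inner_ell2_def cinner_commute[of y x])
  show "inner (x + y) z = inner x z + inner y z"
    by (simp add: inner_ell2_def cinner_add_left)
  show "inner (r *\<^sub>R x) y = r * inner x y"
    by (simp add: inner_ell2_def scaleR_ell2_def cinner_cscale_left)
  show "0 \<le> inner x x"
    unfolding inner_ell2_def Re_cinner_self by (rule infsum_nonneg) simp
  show "inner x x = 0 \<longleftrightarrow> x = 0"
  proof
    assume 0: "inner x x = 0"
    have "(cmod (coord x j))\<^sup>2 = 0" for j
      by (rule nonneg_infsum_le_0D[OF _ coord_summable])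
        (use 0 in \<open>auto simp: inner_ell2_def Re_cinner_self\<close>)
    then show "x = 0" by (intro ell2_eqI) simp
  qed (simp add: inner_ell2_def cinner_def)
qed

end

lemma norm_ell2_eq: "norm x = sqrt (\<Sum>\<^sub>\<infinity>j. (cmod (coord x j))\<^sup>2)" for x :: "'a ell2"
  by (simp add: norm_ell2_def Re_cinner_self)

lemma norm_cscale: "norm (c *\<^sub>c x) = cmod c * norm x"
  by (simp add: norm_ell2_eq norm_mult power_mult_distrib infsum_cmult_right' real_sqrt_mult)

lemma cinner_Cauchy_Schwarz: "cmod (cinner x y) \<le> norm x * norm y"
proof (cases "cinner x y = 0")
  case False
  define c where "c = cinner x y"
  have "complex_of_real ((cmod c)\<^sup>2) = cinner (cnj c *\<^sub>c x) y"
    unfolding complex_norm_square cinner_cscale_left by (simp add: c_def mult.commute)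
  then have "(cmod c)\<^sup>2 = inner (cnj c *\<^sub>c x) y"
    unfolding inner_ell2_def by (metis Re_complex_of_real)
  also have "\<dots> \<le> norm (cnj c *\<^sub>c x) * norm y" by (rule norm_cauchy_schwarz)
  finally have "cmod c * cmod c \<le> cmod c * (norm x * norm y)"
    by (simp add: norm_cscale power2_eq_square)
  with False show ?thesis by (simp add: c_def)
qed simp

lift_definition basis_vec :: "'a \<Rightarrow> 'a ell2" is "\<lambda>a j. if j = a then 1 else 0"
  by (rule finite_nonzero_values_imp_summable_on) (simp add: if_distrib cong: if_cong)

lemma coord_basis_vec [simp]: "coord (basis_vec a) j = (if j = a then 1 else 0)"
  by (rule fun_cong[OF basis_vec.rep_eq])

lemma cinner_basis_vec [simp]: "cinner x (basis_vec a) = coord x a"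
  unfolding cinner_def
  by (intro infsumI has_sum_finite_neutralI[of "{a}"]) auto

lemma vector_space_cscale: "vector_space ((*\<^sub>c) :: complex \<Rightarrow> 'a ell2 \<Rightarrow> 'a ell2)"
  by standard (rule ell2_eqI, simp add: algebra_simps)+

abbreviation cspan :: "'a ell2 set \<Rightarrow> 'a ell2 set"
  where "cspan \<equiv> module.span (*\<^sub>c)"

section \<open>Bounded operators and unital C*-algebras of operators\<close>

type_synonym 'a op = "'a ell2 \<Rightarrow>\<^sub>L 'a ell2"

text \<open>The library type \<^typ>\<open>'a op\<close> consists of the bounded real-linear maps;
  the bounded operators on the complex Hilbert space are the complex-linear ones among them.\<close>

definition bounded_ops :: "'a op set"
  where "bounded_ops = {A. \<forall>c x. blinfun_apply A (c *\<^sub>c x) = c *\<^sub>c blinfun_apply A x}"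

lemma bounded_linear_cscale: "bounded_linear (\<lambda>x. c *\<^sub>c x)"
  by (rule bounded_linear_intro[of _ "cmod c"])
    (auto intro!: ell2_eqI simp: norm_cscale algebra_simps)

definition op_scale :: "complex \<Rightarrow> 'a op \<Rightarrow> 'a op" (infixr "*\<^sub>o" 75)
  where "c *\<^sub>o A = Blinfun (\<lambda>x. c *\<^sub>c blinfun_apply A x)"

lemma op_scale_apply: "blinfun_apply (c *\<^sub>o A) x = c *\<^sub>c blinfun_apply A x"
  unfolding op_scale_def
  by (simp add: bounded_linear_Blinfun_apply
      bounded_linear_compose[OF bounded_linear_cscale blinfun.bounded_linear_right])

text \<open>The adjoint of a complex-linear bounded operator exists by the Riesz representation theorem
  and is unique by \<open>adj_eqI\<close> below; only such operators are ever passed to \<open>adj\<close>.\<close>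

definition adj :: "'a op \<Rightarrow> 'a op"
  where "adj A = (SOME B. \<forall>x y. cinner (blinfun_apply A x) y = cinner x (blinfun_apply B y))"

lemma adj_eqI:
  assumes "\<And>x y. cinner (blinfun_apply A x) y = cinner x (blinfun_apply B y)"
  shows "adj A = B"
  unfolding adj_def
proof (rule some_equality)
  fix C assume C: "\<forall>x y. cinner (blinfun_apply A x) y = cinner x (blinfun_apply C y)"
  show "C = B"
  proof (rule blinfun_eqI, rule ell2_eqI)
    fix y j
    have "cinner (basis_vec j) (blinfun_apply C y) = cinner (basis_vec j) (blinfun_apply B y)"
      using C assms by metis
    then show "coord (blinfun_apply C y) j = coord (blinfun_apply B y) j"
      by (metis cinner_basis_vec cinner_commute)
  qed
qed (use assms in blast)

definition unital_cstar_algebra :: "'a op set \<Rightarrow> bool"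
  where "unital_cstar_algebra S \<longleftrightarrow>
    S \<subseteq> bounded_ops \<and> id_blinfun \<in> S \<and>
    (\<forall>A\<in>S. \<forall>B\<in>S. A + B \<in> S \<and> A o\<^sub>L B \<in> S) \<and>
    (\<forall>A\<in>S. \<forall>c. c *\<^sub>o A \<in> S) \<and>
    (\<forall>A\<in>S. adj A \<in> S) \<and>
    closed S"

definition orthogonal_projection_onto :: "'a op \<Rightarrow> 'a ell2 set \<Rightarrow> bool"
  where "orthogonal_projection_onto P M \<longleftrightarrow>
    P \<in> bounded_ops \<and>
    (\<forall>x. blinfun_apply P x \<in> M \<and> (\<forall>m\<in>M. cinner (x - blinfun_apply P x) m = 0))"

text \<open>\<open>S = T \<oplus> U\<close> as an internal direct sum of algebras.\<close>

definition algebra_direct_sum :: "'a op set \<Rightarrow> 'a op set \<Rightarrow> 'a op set \<Rightarrow> bool"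
  where "algebra_direct_sum S T U \<longleftrightarrow>
    S = {A + B |A B. A \<in> T \<and> B \<in> U} \<and> T \<inter> U = {0} \<and>
    (\<forall>A\<in>T. \<forall>B\<in>U. A o\<^sub>L B = 0 \<and> B o\<^sub>L A = 0)"

definition cline :: "'a op \<Rightarrow> 'a op set"
  where "cline A = range (\<lambda>c. c *\<^sub>o A)"

section \<open>The Boolean C*-algebra and its automorphisms\<close>

text \<open>The index set is \<^typ>\<open>int option\<close>, where \<^term>\<open>None\<close> plays the role of the symbol \<open>#\<close>.
  A vector \<open>x\<close> corresponds to \<open>c \<oplus> g\<close> with \<open>c = coord x None\<close> and \<open>g i = coord x (Some i)\<close>.\<close>

abbreviation vacuum :: "int option ell2"
  where "vacuum \<equiv> basis_vec None"

lemma bounded_linear_rank_one: "bounded_linear (\<lambda>x. coord x a *\<^sub>c u)"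
proof (rule bounded_linear_intro[of _ "norm u"])
  fix x
  have "cmod (coord x a) \<le> norm x * norm (basis_vec a)"
    by (metis cinner_Cauchy_Schwarz cinner_basis_vec)
  also have "norm (basis_vec a) = 1"
    by (simp add: norm_ell2_def)
  finally show "norm (coord x a *\<^sub>c u) \<le> norm x * norm u"
    by (simp add: norm_cscale mult_right_mono)
qed (auto intro!: ell2_eqI simp: algebra_simps)

lift_definition creation :: "int \<Rightarrow> int option op"
  is "\<lambda>i x. coord x None *\<^sub>c basis_vec (Some i)"
  by (rule bounded_linear_rank_one)

lift_definition annihilation :: "int \<Rightarrow> int option op"
  is "\<lambda>i x. cinner x (basis_vec (Some i)) *\<^sub>c vacuum"
  by (simp add: bounded_linear_rank_one)

definition boolean_cstar_algebra :: "int option op set"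
  where "boolean_cstar_algebra = unital_cstar_algebra hull (range annihilation)"

lift_definition vacuum_projection :: "int option op"
  is "\<lambda>x. coord x None *\<^sub>c vacuum"
  by (rule bounded_linear_rank_one)

text \<open>For a bijection \<open>g\<close> of the integers, \<open>perm_unitary g\<close> fixes the vacuum and maps the basis
  vector at \<open>i\<close> to the one at \<open>g i\<close>. The value for other \<open>g\<close> is irrelevant.\<close>

lemma square_summable_perm:
  fixes f :: "int option \<Rightarrow> complex"
  assumes "bij g"
  shows "(\<lambda>j. (cmod (f (map_option g j)))\<^sup>2) summable_on UNIV
      \<longleftrightarrow> (\<lambda>j. (cmod (f j))\<^sup>2) summable_on UNIV"
    and "(\<Sum>\<^sub>\<infinity>j. (cmod (f (map_option g j)))\<^sup>2) = (\<Sum>\<^sub>\<infinity>j. (cmod (f j))\<^sup>2)"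
    and "(\<Sum>\<^sub>\<infinity>j. f (map_option g j)) = (\<Sum>\<^sub>\<infinity>j. f j)"
proof -
  have bij: "bij_betw (map_option g) UNIV UNIV"
    using assms
    by (intro bij_betw_byWitness[where f' = "map_option (inv g)"])
      (auto simp: option.map_comp o_def bij_is_inj bij_is_surj surj_f_inv_f option.map_ident)
  show "(\<lambda>j. (cmod (f (map_option g j)))\<^sup>2) summable_on UNIV
      \<longleftrightarrow> (\<lambda>j. (cmod (f j))\<^sup>2) summable_on UNIV"
    by (rule summable_on_reindex_bij_betw[OF bij])
  show "(\<Sum>\<^sub>\<infinity>j. (cmod (f (map_option g j)))\<^sup>2) = (\<Sum>\<^sub>\<infinity>j. (cmod (f j))\<^sup>2)"
    by (rule infsum_reindex_bij_betw[OF bij])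
  show "(\<Sum>\<^sub>\<infinity>j. f (map_option g j)) = (\<Sum>\<^sub>\<infinity>j. f j)"
    by (rule infsum_reindex_bij_betw[OF bij])
qed

lift_definition perm_vec :: "(int \<Rightarrow> int) \<Rightarrow> int option ell2 \<Rightarrow> int option ell2"
  is "\<lambda>g f j. if bij g then f (map_option (inv g) j) else f j"
  subgoal for g f
    using square_summable_perm(1)[of "inv g" f] by (cases "bij g") (simp_all add: bij_imp_bij_inv)
  done

lemma coord_perm_vec: "bij g \<Longrightarrow> coord (perm_vec g x) j = coord x (map_option (inv g) j)"
  by (simp add: perm_vec.rep_eq)

lift_definition perm_unitary :: "(int \<Rightarrow> int) \<Rightarrow> int option op" is perm_vec
proof (rule bounded_linear_intro[of _ 1])
  fix g :: "int \<Rightarrow> int" and x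
  show "norm (perm_vec g x) \<le> norm x * 1"
    using square_summable_perm(2)[of "inv g" "coord x"]
    by (cases "bij g") (simp_all add: norm_ell2_eq perm_vec.rep_eq bij_imp_bij_inv)
qed (auto intro!: ell2_eqI simp: perm_vec.rep_eq)

definition perm_automorphism :: "(int \<Rightarrow> int) \<Rightarrow> int option op \<Rightarrow> int option op"
  where "perm_automorphism g A = perm_unitary g o\<^sub>L A o\<^sub>L adj (perm_unitary g)"

definition shift_automorphism :: "int option op \<Rightarrow> int option op"
  where "shift_automorphism = perm_automorphism (\<lambda>i. i + 1)"

definition fixed_permutations :: "int option op set"
  where "fixed_permutations = {A \<in> boolean_cstar_algebra.
    \<forall>g. bij g \<and> finite {i. g i \<noteq> i} \<longrightarrow> perm_automorphism g A = A}"

definition fixed_shift :: "int option op set"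
  where "fixed_shift = {A \<in> boolean_cstar_algebra. shift_automorphism A = A}"

text \<open>Sanity checks: creation and annihilation operators are mutually adjoint, and the unitaries
  and automorphisms act on the basis and on the generators as they should.\<close>

lemma cinner_basis_vec_left [simp]: "cinner (basis_vec a) x = cnj (coord x a)"
  by (metis cinner_basis_vec cinner_commute)

lemma adj_annihilation: "adj (annihilation i) = creation i"
  by (rule adj_eqI)
    (simp add: annihilation.rep_eq creation.rep_eq cinner_cscale_left cinner_cscale_right)

lemma perm_unitary_basis_vec:
  assumes "bij g"
  shows "blinfun_apply (perm_unitary g) vacuum = vacuum"
    and "blinfun_apply (perm_unitary g) (basis_vec (Some i)) = basis_vec (Some (g i))"
proof -
  show "blinfun_apply (perm_unitary g) vacuum = vacuum"
    by (rule ell2_eqI) (use assms in \<open>auto simp: perm_unitary.rep_eq coord_perm_vec\<close>)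
  have "map_option (inv g) j = Some i \<longleftrightarrow> j = Some (g i)" for j
    using assms by (cases j) (auto simp: bij_is_inj bij_is_surj surj_f_inv_f inv_f_f)
  then show "blinfun_apply (perm_unitary g) (basis_vec (Some i)) = basis_vec (Some (g i))"
    by (intro ell2_eqI) (use assms in \<open>auto simp: perm_unitary.rep_eq coord_perm_vec\<close>)
qed

lemma adj_perm_unitary:
  assumes "bij g"
  shows "adj (perm_unitary g) = perm_unitary (inv g)"
proof (rule adj_eqI)
  fix x y :: "int option ell2"
  have "cinner (blinfun_apply (perm_unitary g) x) y
      = (\<Sum>\<^sub>\<infinity>j. coord x (map_option (inv g) j) * cnj (coord y j))"
    using assms by (simp add: cinner_def perm_unitary.rep_eq coord_perm_vec)
  also have "\<dots> = (\<Sum>\<^sub>\<infinity>j. coord x (map_option (inv g) (map_option g j)) * cnj (coord y (map_option g j)))"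
    by (rule square_summable_perm(3)[OF assms, symmetric])
  also have "\<dots> = cinner x (blinfun_apply (perm_unitary (inv g)) y)"
    using assms
    by (simp add: cinner_def perm_unitary.rep_eq coord_perm_vec bij_imp_bij_inv inv_inv_eq
        option.map_comp o_def bij_is_inj option.map_ident)
  finally show "cinner (blinfun_apply (perm_unitary g) x) y
      = cinner x (blinfun_apply (perm_unitary (inv g)) y)" .
qed

lemma perm_automorphism_annihilation:
  assumes "bij g"
  shows "perm_automorphism g (annihilation i) = annihilation (g i)"
proof (rule blinfun_eqI, rule ell2_eqI)
  fix x j
  show "coord (blinfun_apply (perm_automorphism g (annihilation i)) x) j
      = coord (blinfun_apply (annihilation (g i)) x) j"
    using assms
    by (cases j) (simp_all add: perm_automorphism_def adj_perm_unitary annihilation.rep_eq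
        perm_unitary.rep_eq coord_perm_vec bij_imp_bij_inv inv_inv_eq)
qed

end

theory Submission
  imports Defs
begin

text \<open>Every element \<open>A\<close> of the Boolean algebra, being a compact operator plus \<open>c I\<close>, satisfies
  \<open>(A - c) e\<^sub>n \<longrightarrow> 0\<close>, and likewise for its adjoint; operators with this property form a unital
  C*-algebra, so compactness itself never has to be discussed. If \<open>A\<close> commutes with unitaries
  \<open>U\<^sub>g\<close> carrying \<open>e\<^sub>i\<close> to \<open>e\<^sub>n\<close> for all large \<open>n\<close>, then \<open>norm ((A - c) e\<^sub>i) = norm ((A - c) e\<^sub>n)\<close>
  forces \<open>A e\<^sub>i = c e\<^sub>i\<close>, while the coordinates of \<open>A e\<^sub>#\<close> at \<open>i\<close> and \<open>n\<close> agree and tend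
  to \<open>0\<close>, so that \<open>A e\<^sub>#\<close> is a multiple of \<open>e\<^sub>#\<close>.\<close>

section \<open>Expansion in the canonical basis\<close>

lemma norm_basis_vec [simp]: "norm (basis_vec a) = 1"
  by (simp add: norm_ell2_def)

lemma cinner_add_right: "cinner x (y + z) = cinner x y + cinner x z"
  by (metis cinner_add_left cinner_commute complex_cnj_add)

lemma cinner_zero_right [simp]: "cinner x 0 = 0"
  by (simp add: cinner_def)

lemma cinner_sum_right: "cinner x (sum f F) = (\<Sum>j\<in>F. cinner x (f j))"
  by (induction F rule: infinite_finite_induct) (simp_all add: cinner_add_right)

lemma coord_sum: "coord (sum f F) a = (\<Sum>j\<in>F. coord (f j) a)"
  by (induction F rule: infinite_finite_induct) simp_all

lemma norm_ell2_square: "(norm x)\<^sup>2 = (\<Sum>\<^sub>\<infinity>j. (cmod (coord x j))\<^sup>2)" for x :: "'a ell2"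
  by (simp add: norm_ell2_eq infsum_nonneg)

lemma coord_sum_basis:
  assumes "finite F"
  shows "coord (\<Sum>j\<in>F. t j *\<^sub>c basis_vec j) a = (if a \<in> F then t a else 0)"
  using assms by (simp add: coord_sum if_distrib cong: if_cong)

lemma norm_sum_basis_square:
  assumes "finite F"
  shows "(norm (\<Sum>j\<in>F. t j *\<^sub>c basis_vec j))\<^sup>2 = (\<Sum>j\<in>F. (cmod (t j))\<^sup>2)"
  unfolding norm_ell2_square
  by (intro infsumI has_sum_finite_neutralI[of F]) (use assms in \<open>auto simp: coord_sum_basis\<close>)

text \<open>The partial sum over F agrees with x on F and vanishes elsewhere, so its squared
  distance to x is the squared norm of x minus the part carried by F, which tends to 0.\<close>

lemma basis_expansion: "((\<lambda>j. coord x j *\<^sub>c basis_vec j) has_sum x) UNIV"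
proof -
  define S where "S F = (\<Sum>j\<in>F. coord x j *\<^sub>c basis_vec j)" for F
  have rest: "(norm (S F - x))\<^sup>2 = (norm x)\<^sup>2 - (\<Sum>j\<in>F. (cmod (coord x j))\<^sup>2)"
    if F: "finite F" for F
  proof -
    \<comment> \<open>The finite part is written as a finitely supported family over the whole index
      set, so that both sums can be added termwise.\<close>
    have "((\<lambda>j. (cmod (coord x j))\<^sup>2 + - (if j \<in> F then (cmod (coord x j))\<^sup>2 else 0)) has_sum
        ((norm x)\<^sup>2 + - (\<Sum>j\<in>F. (cmod (coord x j))\<^sup>2))) UNIV"
      unfolding norm_ell2_square
      by (intro has_sum_add has_sum_uminusI has_sum_infsum coord_summable has_sum_finite_neutralI[of F])
        (use F in auto)
    also have "(\<lambda>j. (cmod (coord x j))\<^sup>2 + - (if j \<in> F then (cmod (coord x j))\<^sup>2 else 0))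
        = (\<lambda>j. (cmod (coord (S F - x) j))\<^sup>2)"
      using F by (auto simp: S_def coord_sum_basis)
    finally show ?thesis
      unfolding norm_ell2_square[of "S F - x"] by (simp add: infsumI)
  qed
  have "((\<lambda>j. (cmod (coord x j))\<^sup>2) has_sum (norm x)\<^sup>2) UNIV"
    unfolding norm_ell2_square by (intro has_sum_infsum coord_summable)
  then have "((\<lambda>F. \<Sum>j\<in>F. (cmod (coord x j))\<^sup>2) \<longlongrightarrow> (norm x)\<^sup>2) (finite_subsets_at_top UNIV)"
    by (simp add: has_sum_def)
  then have "((\<lambda>F. (norm x)\<^sup>2 - (\<Sum>j\<in>F. (cmod (coord x j))\<^sup>2)) \<longlongrightarrow> (norm x)\<^sup>2 - (norm x)\<^sup>2)
      (finite_subsets_at_top UNIV)"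
    by (intro tendsto_intros)
  then have "((\<lambda>F. (norm (S F - x))\<^sup>2) \<longlongrightarrow> 0) (finite_subsets_at_top UNIV)"
    by (rule Lim_transform_eventually[THEN tendsto_eq_rhs])
      (auto simp: rest intro!: eventually_finite_subsets_at_top_weakI)
  then have "((\<lambda>F. sqrt ((norm (S F - x))\<^sup>2)) \<longlongrightarrow> sqrt 0) (finite_subsets_at_top UNIV)"
    by (intro tendsto_intros)
  then have "((\<lambda>F. norm (S F - x)) \<longlongrightarrow> 0) (finite_subsets_at_top UNIV)"
    by simp
  then have "(S \<longlongrightarrow> x) (finite_subsets_at_top UNIV)"
    using LIM_zero_cancel tendsto_norm_zero_iff by blast
  then show ?thesis
    unfolding has_sum_def S_def .
qed

section \<open>Adjoints of bounded operators\<close>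

lemma bounded_opsD: "A \<in> bounded_ops \<Longrightarrow> blinfun_apply A (c *\<^sub>c x) = c *\<^sub>c blinfun_apply A x"
  by (simp add: bounded_ops_def)

text \<open>Continuity passes to the infinite basis expansion, and complex linearity pulls the
  coefficients out.\<close>

lemma bounded_ops_eqI:
  assumes "A \<in> bounded_ops" "B \<in> bounded_ops"
    and "\<And>j. blinfun_apply A (basis_vec j) = blinfun_apply B (basis_vec j)"
  shows "A = B"
proof (rule blinfun_eqI)
  fix x
  have "((\<lambda>j. blinfun_apply C (coord x j *\<^sub>c basis_vec j)) has_sum blinfun_apply C x) UNIV"
    for C :: "'a op"
    using has_sum_bounded_linear[OF blinfun.bounded_linear_right basis_expansion] .
  moreover have "blinfun_apply A (coord x j *\<^sub>c basis_vec j)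
      = blinfun_apply B (coord x j *\<^sub>c basis_vec j)" for j
    using assms by (simp add: bounded_opsD)
  ultimately show "blinfun_apply A x = blinfun_apply B x"
    by (metis (no_types, lifting) has_sum_cong has_sum_unique)
qed

lemma bounded_linear_cinner_left: "bounded_linear (\<lambda>x. cinner x y)"
  by (rule bounded_linear_intro[of _ "norm y"])
    (simp_all add: cinner_add_left scaleR_ell2_def cinner_cscale_left scaleR_conv_of_real
      cinner_Cauchy_Schwarz)

text \<open>The adjoint is built by coordinates: the one at j of the image of y has to be the inner
  product of y with A e_j. Square summability of this family is the only real issue.\<close>

lemma ex_adjoint:
  assumes A: "A \<in> bounded_ops"
  shows "\<exists>B. \<forall>x y. cinner (blinfun_apply A x) y = cinner x (blinfun_apply B y)"
proof -
  define t where "t y j = cinner y (blinfun_apply A (basis_vec j))" for y j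
  have bound: "(\<Sum>j\<in>F. (cmod (t y j))\<^sup>2) \<le> (norm A * norm y)\<^sup>2" if F: "finite F" for F y
  proof -
    define s where "s = (\<Sum>j\<in>F. (cmod (t y j))\<^sup>2)"
    \<comment> \<open>Test vector chosen so that the inner product of y with A v is the squared norm
      of v. Cauchy-Schwarz then bounds \<open>norm v\<close> after cancelling one factor.\<close>
    define v where "v = (\<Sum>j\<in>F. t y j *\<^sub>c basis_vec j)"
    have s: "(norm v)\<^sup>2 = s"
      using F by (simp add: v_def s_def norm_sum_basis_square)
    have "cinner y (blinfun_apply A v) = (\<Sum>j\<in>F. cnj (t y j) * t y j)"
      by (simp add: v_def blinfun.sum_right cinner_sum_right bounded_opsD[OF A]
          cinner_cscale_right t_def)
    also have "\<dots> = complex_of_real s"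
      by (simp only: s_def of_real_sum complex_norm_square mult.commute)
    finally have "s \<le> cmod (cinner y (blinfun_apply A v))"
      by simp
    also have "\<dots> \<le> norm y * norm (blinfun_apply A v)"
      by (rule cinner_Cauchy_Schwarz)
    also have "\<dots> \<le> norm y * (norm A * norm v)"
      by (intro mult_left_mono norm_blinfun) simp
    finally have le: "norm v * norm v \<le> (norm A * norm y) * norm v"
      using s by (simp add: power2_eq_square mult_ac)
    have "norm v \<le> norm A * norm y"
      using le by (cases "norm v = 0") (auto simp: mult_le_cancel_right)
    then show ?thesis
      unfolding s_def[symmetric] s[symmetric] by (intro power_mono) auto
  qed
  have summable: "(\<lambda>j. (cmod (t y j))\<^sup>2) summable_on UNIV" for y
  proof (rule nonneg_bdd_above_summable_on)
    show "bdd_above (sum (\<lambda>j. (cmod (t y j))\<^sup>2) ` {F. F \<subseteq> UNIV \<and> finite F})"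
      by (rule bdd_aboveI2[of _ _ "(norm A * norm y)\<^sup>2"]) (simp add: bound)
  qed simp
  define B where "B y = Abs_ell2 (t y)" for y
  have coord_B: "coord (B y) = t y" for y
    unfolding B_def using summable by (simp add: Abs_ell2_inverse)
  have "bounded_linear B"
  proof (rule bounded_linear_intro[of _ "norm A"])
    fix y
    have "(norm (B y))\<^sup>2 \<le> (norm A * norm y)\<^sup>2"
      unfolding norm_ell2_square coord_B by (rule infsum_le_finite_sums[OF summable bound])
    then have "norm (B y) \<le> norm A * norm y"
      by (rule power2_le_imp_le) simp
    then show "norm (B y) \<le> norm y * norm A"
      by (simp only: mult.commute)
  qed (auto intro!: ell2_eqI simp: coord_B t_def cinner_add_left scaleR_ell2_def cinner_cscale_left)
  then have B_apply: "blinfun_apply (Blinfun B) = B"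
    by (rule bounded_linear_Blinfun_apply)
  have "cinner (blinfun_apply A x) y = cinner x (blinfun_apply (Blinfun B) y)" for x y
  proof -
    have eq: "cinner (blinfun_apply A (coord x j *\<^sub>c basis_vec j)) y
        = coord x j * cnj (coord (B y) j)" for j
      unfolding coord_B t_def bounded_opsD[OF A] cinner_cscale_left
      by (simp only: cinner_commute[of "blinfun_apply A (basis_vec j)" y])
    \<comment> \<open>A continuous functional applied to the basis expansion of x yields termwise
      the series that defines the right-hand inner product.\<close>
    have "((\<lambda>j. cinner (blinfun_apply A (coord x j *\<^sub>c basis_vec j)) y) has_sum
        cinner (blinfun_apply A x) y) UNIV"
      by (rule has_sum_bounded_linear[OF _ basis_expansion])
        (rule bounded_linear_compose[OF bounded_linear_cinner_left blinfun.bounded_linear_right])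
    then show ?thesis
      unfolding eq B_apply cinner_def[of x] by (rule infsumI[symmetric])
  qed
  then show ?thesis by blast
qed

text \<open>Existence from \<open>ex_adjoint\<close> and uniqueness from \<open>adj_eqI\<close>
  together replace the choice operator in \<open>adj\<close> by its defining property.\<close>

lemma cinner_adj:
  "A \<in> bounded_ops \<Longrightarrow> cinner (blinfun_apply A x) y = cinner x (blinfun_apply (adj A) y)"
  using ex_adjoint[of A] adj_eqI[of A] by metis

lemma cinner_adj_left:
  "A \<in> bounded_ops \<Longrightarrow> cinner (blinfun_apply (adj A) x) y = cinner x (blinfun_apply A y)"
  by (metis cinner_adj cinner_commute)

lemma adj_adj: "A \<in> bounded_ops \<Longrightarrow> adj (adj A) = A"
  by (rule adj_eqI) (rule cinner_adj_left)

lemma coord_eq_cinner: "coord x j = cinner x (basis_vec j)"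
  by simp

lemma adj_bounded_ops: "A \<in> bounded_ops \<Longrightarrow> adj A \<in> bounded_ops"
  unfolding bounded_ops_def mem_Collect_eq
  \<comment> \<open>Coordinates are turned into inner products with basis vectors, where the adjoint
    can be moved across; the simp rule \<open>cinner_basis_vec\<close> would undo this and is
    removed.\<close>
  by (intro allI ell2_eqI, simp only: coord_cscale, simp only: coord_eq_cinner)
    (simp add: cinner_adj_left bounded_ops_def cinner_cscale_left del: cinner_basis_vec)

lemma bounded_ops_closure:
  "A \<in> bounded_ops \<Longrightarrow> B \<in> bounded_ops \<Longrightarrow> A + B \<in> bounded_ops"
  "A \<in> bounded_ops \<Longrightarrow> B \<in> bounded_ops \<Longrightarrow> A - B \<in> bounded_ops"
  "A \<in> bounded_ops \<Longrightarrow> B \<in> bounded_ops \<Longrightarrow> A o\<^sub>L B \<in> bounded_ops"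
  "A \<in> bounded_ops \<Longrightarrow> c *\<^sub>o A \<in> bounded_ops"
  by (auto simp: bounded_ops_def blinfun.add_left blinfun.diff_left op_scale_apply
      intro!: ell2_eqI simp: algebra_simps)

lemma id_bounded_ops: "id_blinfun \<in> bounded_ops"
  by (simp add: bounded_ops_def)

lemma cinner_diff_right: "cinner x (y - z) = cinner x y - cinner x z"
  by (metis add_diff_cancel_right' cinner_add_right diff_add_cancel)

lemma cinner_diff_left: "cinner (x - y) z = cinner x z - cinner y z"
  by (metis add_diff_cancel_right' cinner_add_left diff_add_cancel)

lemma adj_simps:
  "A \<in> bounded_ops \<Longrightarrow> B \<in> bounded_ops \<Longrightarrow> adj (A + B) = adj A + adj B"
  "A \<in> bounded_ops \<Longrightarrow> B \<in> bounded_ops \<Longrightarrow> adj (A - B) = adj A - adj B"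
  "A \<in> bounded_ops \<Longrightarrow> B \<in> bounded_ops \<Longrightarrow> adj (A o\<^sub>L B) = adj B o\<^sub>L adj A"
  "A \<in> bounded_ops \<Longrightarrow> adj (c *\<^sub>o A) = cnj c *\<^sub>o adj A"
  by (auto intro!: adj_eqI simp: blinfun.add_left blinfun.diff_left op_scale_apply cinner_add_left
      cinner_add_right cinner_diff_left cinner_diff_right cinner_cscale_left cinner_cscale_right
      cinner_adj)

lemma adj_id: "adj id_blinfun = id_blinfun"
  by (rule adj_eqI) simp

text \<open>With z the image of y under \<open>adj A\<close>, the squared norm of z is the inner
  product of A z with y; bounding it by Cauchy-Schwarz leaves one factor \<open>norm z\<close> to
  cancel.\<close>

lemma norm_adj_le:
  assumes "A \<in> bounded_ops"
  shows "norm (adj A) \<le> norm A"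
proof (rule norm_blinfun_bound)
  fix y
  let ?z = "blinfun_apply (adj A) y"
  have "(norm ?z)\<^sup>2 = Re (cinner (blinfun_apply A ?z) y)"
    using assms by (simp add: cinner_adj norm_ell2_def Re_cinner_self infsum_nonneg)
  also have "\<dots> \<le> norm (blinfun_apply A ?z) * norm y"
    by (meson cinner_Cauchy_Schwarz complex_Re_le_cmod order_trans)
  also have "\<dots> \<le> (norm A * norm ?z) * norm y"
    by (intro mult_right_mono norm_blinfun) simp
  finally have "norm ?z * norm ?z \<le> (norm A * norm y) * norm ?z"
    by (simp add: power2_eq_square mult_ac)
  then show "norm ?z \<le> norm A * norm y"
    by (cases "norm ?z = 0") (auto simp: mult_le_cancel_right)
qed simp

lemma closed_bounded_ops: "closed (bounded_ops :: 'a op set)"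
proof -
  have "closed {A :: 'a op. blinfun_apply A (c *\<^sub>c x) = c *\<^sub>c blinfun_apply A x}" for c x
    by (intro closed_Collect_eq continuous_intros
        linear_continuous_on bounded_linear_compose[OF bounded_linear_cscale]
        blinfun.bounded_linear_left)
  then show ?thesis
    unfolding bounded_ops_def by (intro closed_Collect_all)
qed

text \<open>The adjoint is additive and norm-decreasing, hence continuous. Closedness of
  \<open>bounded_ops\<close> ensures that the limit is complex linear, so that its adjoint is
  meaningful.\<close>

lemma tendsto_adj:
  assumes X: "\<And>k. X k \<in> bounded_ops" and lim: "X \<longlonglongrightarrow> A"
  shows "(\<lambda>k. adj (X k)) \<longlonglongrightarrow> adj A"
proof -
  have A: "A \<in> bounded_ops"
    using closed_bounded_ops X lim closed_sequentially by blast
  have "(\<lambda>k. norm (X k - A)) \<longlonglongrightarrow> 0"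
    using lim LIM_zero tendsto_norm_zero by blast
  then have "(\<lambda>k. adj (X k) - adj A) \<longlonglongrightarrow> 0"
    by (rule Lim_null_comparison[rotated])
      (use X A in \<open>auto simp: bounded_ops_closure norm_adj_le simp flip: adj_simps(2)\<close>)
  then show ?thesis
    by (rule LIM_zero_cancel)
qed

section \<open>Asymptotically scalar operators\<close>

text \<open>For A = K + c I with K compact this recovers the scalar c. Here n runs through the
  integers to plus infinity only.\<close>

definition asymptotic_to :: "int option op \<Rightarrow> complex \<Rightarrow> bool"
  where "asymptotic_to A c \<longleftrightarrow>
    ((\<lambda>n. blinfun_apply A (basis_vec (Some n)) - c *\<^sub>c basis_vec (Some n)) \<longlongrightarrow> 0) at_top"

text \<open>The condition on the adjoint is not automatic: the partial isometry sending e_{-n} to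
  e_n for n > 0 and killing all other basis vectors satisfies the first condition with scalar 0, but
  its adjoint sends e_n to e_{-n}.\<close>

definition asymptotically_scalar :: "int option op set"
  where "asymptotically_scalar =
    {A \<in> bounded_ops. (\<exists>c. asymptotic_to A c) \<and> (\<exists>c. asymptotic_to (adj A) c)}"

lemma asymptotic_to_add:
  assumes "asymptotic_to A c" "asymptotic_to B d"
  shows "asymptotic_to (A + B) (c + d)"
proof -
  have "(A + B) v - (c + d) *\<^sub>c v = (A v - c *\<^sub>c v) + (B v - d *\<^sub>c v)" for v
    by (rule ell2_eqI) (simp add: blinfun.add_left algebra_simps)
  then show ?thesis
    using tendsto_add[OF assms[unfolded asymptotic_to_def]] by (simp add: asymptotic_to_def)
qed

lemma asymptotic_to_compose:
  assumes A: "A \<in> bounded_ops" "asymptotic_to A c" and B: "asymptotic_to B d"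
  shows "asymptotic_to (A o\<^sub>L B) (c * d)"
proof -
  have "(A o\<^sub>L B) v - (c * d) *\<^sub>c v = A (B v - d *\<^sub>c v) + d *\<^sub>c (A v - c *\<^sub>c v)" for v
    by (rule ell2_eqI) (simp add: blinfun.diff_right bounded_opsD[OF A(1)] algebra_simps)
  moreover have "((\<lambda>n. A (B (basis_vec (Some n)) - d *\<^sub>c basis_vec (Some n))
      + d *\<^sub>c (A (basis_vec (Some n)) - c *\<^sub>c basis_vec (Some n))) \<longlongrightarrow> 0 + 0) at_top"
    using A(2) B unfolding asymptotic_to_def
    by (intro tendsto_add bounded_linear.tendsto_zero[OF blinfun.bounded_linear_right]
        bounded_linear.tendsto_zero[OF bounded_linear_cscale])
  ultimately show ?thesis
    by (simp add: asymptotic_to_def)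
qed

lemma asymptotic_to_scale:
  assumes "asymptotic_to A c"
  shows "asymptotic_to (d *\<^sub>o A) (d * c)"
proof -
  have "(d *\<^sub>o A) v - (d * c) *\<^sub>c v = d *\<^sub>c (A v - c *\<^sub>c v)" for v
    by (rule ell2_eqI) (simp add: op_scale_apply algebra_simps)
  then show ?thesis
    using bounded_linear.tendsto_zero[OF bounded_linear_cscale assms[unfolded asymptotic_to_def]]
    by (simp add: asymptotic_to_def)
qed

lemma asymptotic_to_id: "asymptotic_to id_blinfun 1"
proof -
  have "id_blinfun v - 1 *\<^sub>c v = 0" for v :: "int option ell2"
    by (rule ell2_eqI) simp
  then show ?thesis
    by (simp add: asymptotic_to_def)
qed

lemma asymptotic_to_0:
  assumes "\<And>n. n > i \<Longrightarrow> blinfun_apply A (basis_vec (Some n)) = 0"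
  shows "asymptotic_to A 0"
  unfolding asymptotic_to_def
proof (rule tendsto_eventually)
  have "A (basis_vec (Some n)) - 0 *\<^sub>c basis_vec (Some n) = 0" if "n > i" for n
    by (rule ell2_eqI) (simp add: assms that)
  then show "\<forall>\<^sub>F n in at_top. A (basis_vec (Some n)) - 0 *\<^sub>c basis_vec (Some n) = 0"
    by (rule eventually_mono[OF eventually_gt_at_top[of i]])
qed

lemma norm_apply_basis_le: "norm (blinfun_apply A (basis_vec j)) \<le> norm A"
  using norm_blinfun[of A "basis_vec j"] by simp

text \<open>Evaluating both operators at the unit vector e_n for large n gives the bound. It makes
  the scalars of a Cauchy sequence of operators a Cauchy sequence.\<close>

lemma asymptotic_to_dist:
  assumes A: "asymptotic_to A c" and B: "asymptotic_to B d"
  shows "cmod (c - d) \<le> norm (A - B)"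
proof -
  let ?e = "\<lambda>n. basis_vec (Some n) :: int option ell2"
  have bound: "cmod (c - d) \<le> norm (A - B)
      + norm (A (?e n) - c *\<^sub>c ?e n) + norm (B (?e n) - d *\<^sub>c ?e n)" for n
  proof -
    have "(c - d) *\<^sub>c ?e n
        = (A - B) (?e n) - (A (?e n) - c *\<^sub>c ?e n) + (B (?e n) - d *\<^sub>c ?e n)"
      by (rule ell2_eqI) (simp add: blinfun.diff_left algebra_simps)
    then have "norm ((c - d) *\<^sub>c ?e n) \<le> norm ((A - B) (?e n))
        + norm (A (?e n) - c *\<^sub>c ?e n) + norm (B (?e n) - d *\<^sub>c ?e n)"
      by (metis (no_types, lifting) add_right_mono norm_triangle_ineq norm_triangle_ineq4 order_trans)
    with norm_apply_basis_le[of "A - B" "Some n"] show ?thesis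
      by (simp add: norm_cscale)
  qed
  have "((\<lambda>n. norm (A - B) + norm (A (?e n) - c *\<^sub>c ?e n)
      + norm (B (?e n) - d *\<^sub>c ?e n)) \<longlongrightarrow> norm (A - B) + 0 + 0) at_top"
    using A B unfolding asymptotic_to_def by (intro tendsto_intros tendsto_norm_zero)
  from tendsto_lowerbound[OF this always_eventually] bound show ?thesis
    by simp
qed

text \<open>The scalars of the approximating operators converge, and a three-way splitting of the
  error shows that their limit serves for A. This gives norm-closedness of
  \<open>asymptotically_scalar\<close>.\<close>

lemma asymptotic_to_limit:
  assumes lim: "X \<longlonglongrightarrow> A" and X: "\<And>k. \<exists>c. asymptotic_to (X k) c"
  shows "\<exists>c. asymptotic_to A c"
proof -
  let ?e = "\<lambda>n. basis_vec (Some n) :: int option ell2"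
  obtain c where c: "\<And>k. asymptotic_to (X k) (c k)"
    using X by metis
  have "Cauchy X"
    using lim by (rule LIMSEQ_imp_Cauchy)
  then have "Cauchy c"
    unfolding Cauchy_def dist_norm
    by (meson asymptotic_to_dist c order_le_less_trans)
  then obtain d where d: "c \<longlonglongrightarrow> d"
    using Cauchy_convergent convergent_def by blast
  have "asymptotic_to A d"
    unfolding asymptotic_to_def
  proof (rule tendstoI)
    fix r :: real assume r: "r > 0"
    have "\<forall>\<^sub>F k in sequentially. dist (X k) A < r / 3 \<and> dist (c k) d < r / 3"
      using tendstoD[OF lim, of "r / 3"] tendstoD[OF d, of "r / 3"] r
      by (intro eventually_conj) auto
    then obtain k where k: "norm (X k - A) < r / 3" "cmod (c k - d) < r / 3"
      by (auto simp: dist_norm dest: eventually_happens)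
    have "norm (A (?e n) - d *\<^sub>c ?e n) < r" if "norm (X k (?e n) - c k *\<^sub>c ?e n) < r / 3" for n
    proof -
      have eq: "A (?e n) - d *\<^sub>c ?e n
          = (X k (?e n) - c k *\<^sub>c ?e n) - (X k - A) (?e n) + (c k - d) *\<^sub>c ?e n"
        by (rule ell2_eqI) (simp add: blinfun.diff_left algebra_simps)
      have "norm (A (?e n) - d *\<^sub>c ?e n) \<le> norm (X k (?e n) - c k *\<^sub>c ?e n)
          + norm ((X k - A) (?e n)) + norm ((c k - d) *\<^sub>c ?e n)"
        unfolding eq
        by (metis (no_types, lifting) add_right_mono norm_triangle_ineq norm_triangle_ineq4 order_trans)
      with that k norm_apply_basis_le[of "X k - A" "Some n"] show ?thesis
        by (simp add: norm_cscale)
    qed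
    moreover have "\<forall>\<^sub>F n in at_top. norm (X k (?e n) - c k *\<^sub>c ?e n) < r / 3"
      using tendstoD[OF c[of k, unfolded asymptotic_to_def], of "r / 3"] r by simp
    ultimately show "\<forall>\<^sub>F n in at_top. dist (A (?e n) - d *\<^sub>c ?e n) 0 < r"
      by (auto elim: eventually_mono)
  qed
  then show ?thesis ..
qed

lemma unital_cstar_asymptotically_scalar: "unital_cstar_algebra asymptotically_scalar"
  unfolding unital_cstar_algebra_def
proof (intro conjI ballI allI)
  show "asymptotically_scalar \<subseteq> bounded_ops"
    by (auto simp: asymptotically_scalar_def)
  show "id_blinfun \<in> asymptotically_scalar"
    using asymptotic_to_id by (auto simp: asymptotically_scalar_def id_bounded_ops adj_id)
  show "closed asymptotically_scalar"
    unfolding closed_sequential_limits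
  proof (intro allI impI, elim conjE)
    fix X A assume X: "\<forall>k. X k \<in> asymptotically_scalar" and lim: "X \<longlonglongrightarrow> A"
    then have X_ops: "X k \<in> bounded_ops" for k
      by (simp add: asymptotically_scalar_def)
    then have "A \<in> bounded_ops"
      using closed_bounded_ops lim closed_sequentially by blast
    then show "A \<in> asymptotically_scalar"
      using X asymptotic_to_limit[OF lim] asymptotic_to_limit[OF tendsto_adj[OF X_ops lim]]
      by (simp add: asymptotically_scalar_def)
  qed
next
  fix A B assume "A \<in> asymptotically_scalar" "B \<in> asymptotically_scalar"
  then show "A + B \<in> asymptotically_scalar" "A o\<^sub>L B \<in> asymptotically_scalar"
    by (auto simp: asymptotically_scalar_def bounded_ops_closure adj_simps adj_bounded_ops
        intro: asymptotic_to_add asymptotic_to_compose[OF adj_bounded_ops] asymptotic_to_compose)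
next
  fix A c assume "A \<in> asymptotically_scalar"
  then show "c *\<^sub>o A \<in> asymptotically_scalar"
    by (simp add: asymptotically_scalar_def bounded_ops_closure adj_simps)
      (metis asymptotic_to_scale)
next
  fix A assume "A \<in> asymptotically_scalar"
  then show "adj A \<in> asymptotically_scalar"
    by (simp add: asymptotically_scalar_def adj_bounded_ops adj_adj)
qed

text \<open>By minimality of the hull only the generators matter; they and their adjoints kill every
  e_n with n > i.\<close>

lemma boolean_subset_asymptotically_scalar: "boolean_cstar_algebra \<subseteq> asymptotically_scalar"
  unfolding boolean_cstar_algebra_def
proof (rule hull_minimal)
  have "annihilation i \<in> asymptotically_scalar" for i
  proof -
    have "annihilation i \<in> bounded_ops"
      by (auto simp: bounded_ops_def annihilation.rep_eq intro!: ell2_eqI)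
    moreover have "asymptotic_to (annihilation i) 0" "asymptotic_to (creation i) 0"
      by (auto intro!: asymptotic_to_0[of i] ell2_eqI simp: annihilation.rep_eq creation.rep_eq)
    ultimately show ?thesis
      by (auto simp: asymptotically_scalar_def adj_annihilation)
  qed
  then show "range annihilation \<subseteq> asymptotically_scalar"
    by blast
qed (rule unital_cstar_asymptotically_scalar)

section \<open>Fixed points\<close>

lemma norm_perm_unitary:
  assumes "bij g"
  shows "norm (blinfun_apply (perm_unitary g) x) = norm x"
  using square_summable_perm(2)[of "inv g" "coord x"] assms
  by (simp add: norm_ell2_eq perm_unitary.rep_eq coord_perm_vec bij_imp_bij_inv)

lemma perm_unitary_cscale:
  "blinfun_apply (perm_unitary g) (c *\<^sub>c x) = c *\<^sub>c blinfun_apply (perm_unitary g) x"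
  by (rule ell2_eqI) (simp add: perm_unitary.rep_eq perm_vec.rep_eq)

lemma perm_unitary_inverse:
  assumes "bij g"
  shows "blinfun_apply (perm_unitary (inv g)) (blinfun_apply (perm_unitary g) x) = x"
    and "blinfun_apply (perm_unitary g) (blinfun_apply (perm_unitary (inv g)) x) = x"
  using assms
  by (auto intro!: ell2_eqI simp: perm_unitary.rep_eq coord_perm_vec bij_imp_bij_inv inv_inv_eq
      option.map_comp o_def bij_is_inj bij_is_surj surj_f_inv_f option.map_ident)

text \<open>As a commutation relation, invariance can be evaluated on basis vectors and passes to
  products of unitaries.\<close>

lemma perm_automorphism_fixed_iff:
  assumes "bij g"
  shows "perm_automorphism g A = A \<longleftrightarrow> perm_unitary g o\<^sub>L A = A o\<^sub>L perm_unitary g"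
proof
  assume "perm_automorphism g A = A"
  then have "(perm_automorphism g A) (perm_unitary g x) = A (perm_unitary g x)" for x
    by simp
  then show "perm_unitary g o\<^sub>L A = A o\<^sub>L perm_unitary g"
    using assms
    by (auto intro!: blinfun_eqI simp: perm_automorphism_def adj_perm_unitary perm_unitary_inverse)
next
  assume "perm_unitary g o\<^sub>L A = A o\<^sub>L perm_unitary g"
  then have "perm_unitary g (A x) = A (perm_unitary g x)" for x
    by (metis blinfun_apply_blinfun_compose)
  then show "perm_automorphism g A = A"
    using assms
    by (auto intro!: blinfun_eqI simp: perm_automorphism_def adj_perm_unitary perm_unitary_inverse)
qed

section \<open>Operators that are scalar on the vacuum line and on its complement\<close>

lemma vacuum_projection_bounded: "vacuum_projection \<in> bounded_ops"
  by (auto simp: bounded_ops_def vacuum_projection.rep_eq intro!: ell2_eqI)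

definition diagonal_op :: "complex \<Rightarrow> complex \<Rightarrow> int option op"
  where "diagonal_op d c = d *\<^sub>o vacuum_projection + c *\<^sub>o (id_blinfun - vacuum_projection)"

lemma coord_diagonal_op:
  "coord (blinfun_apply (diagonal_op d c) x) j = (if j = None then d else c) * coord x j"
  by (simp add: diagonal_op_def blinfun.add_left blinfun.diff_left op_scale_apply
      vacuum_projection.rep_eq)

lemma diagonal_op_bounded: "diagonal_op d c \<in> bounded_ops"
  by (auto simp: bounded_ops_def coord_diagonal_op intro!: ell2_eqI)

lemma annihilation_creation: "annihilation i o\<^sub>L creation i = vacuum_projection"
  by (rule blinfun_eqI, rule ell2_eqI)
    (simp add: annihilation.rep_eq creation.rep_eq vacuum_projection.rep_eq)

text \<open>Any unital C*-algebra containing the annihilators contains the creators as adjoints,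
  hence the vacuum projection as a product, and its complement because of the unit.\<close>

lemma diagonal_op_in_boolean: "diagonal_op d c \<in> boolean_cstar_algebra"
  unfolding boolean_cstar_algebra_def hull_def
proof (rule InterI, elim CollectE conjE)
  fix S :: "int option op set"
  assume S: "unital_cstar_algebra S" and range: "range annihilation \<subseteq> S"
  have id: "id_blinfun \<in> S"
    and add: "\<And>A B. A \<in> S \<Longrightarrow> B \<in> S \<Longrightarrow> A + B \<in> S"
    and comp: "\<And>A B. A \<in> S \<Longrightarrow> B \<in> S \<Longrightarrow> A o\<^sub>L B \<in> S"
    and scale: "\<And>A c. A \<in> S \<Longrightarrow> c *\<^sub>o A \<in> S"
    and adj: "\<And>A. A \<in> S \<Longrightarrow> adj A \<in> S"
    using S by (simp_all add: unital_cstar_algebra_def)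
  have "annihilation 0 \<in> S"
    using range by blast
  then have "annihilation 0 o\<^sub>L adj (annihilation 0) \<in> S"
    by (intro comp adj)
  then have P: "vacuum_projection \<in> S"
    by (simp only: adj_annihilation annihilation_creation)
  have "id_blinfun - vacuum_projection = id_blinfun + (-1) *\<^sub>o vacuum_projection"
    by (rule blinfun_eqI, rule ell2_eqI)
      (simp add: blinfun.add_left blinfun.diff_left op_scale_apply)
  then show "diagonal_op d c \<in> S"
    unfolding diagonal_op_def by (simp only: id add scale P)
qed

text \<open>The eigenvalue at an index depends only on whether the index is \<open>None\<close>, and
  \<open>map_option\<close> preserves that.\<close>

lemma perm_automorphism_diagonal_op:
  assumes "bij g"
  shows "perm_automorphism g (diagonal_op d c) = diagonal_op d c"
  unfolding perm_automorphism_fixed_iff[OF assms]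
  by (rule blinfun_eqI, rule ell2_eqI)
    (use assms in \<open>simp add: perm_unitary.rep_eq coord_perm_vec coord_diagonal_op\<close>)

text \<open>The transitivity hypothesis is one-sided so that the powers of the shift satisfy it.\<close>

lemma fixed_imp_diagonal_op:
  assumes A: "A \<in> boolean_cstar_algebra"
    and trans: "\<And>i n. i < n \<Longrightarrow> \<exists>g. bij g \<and> g i = n \<and> perm_unitary g o\<^sub>L A = A o\<^sub>L perm_unitary g"
  shows "\<exists>d c. A = diagonal_op d c"
proof -
  let ?e = "\<lambda>n. basis_vec (Some n) :: int option ell2"
  obtain c c' where ops: "A \<in> bounded_ops" and c: "asymptotic_to A c"
    and c': "asymptotic_to (adj A) c'"
    using A boolean_subset_asymptotically_scalar by (auto simp: asymptotically_scalar_def)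
  have comm: "\<exists>g. bij g \<and> g i = n \<and> (\<forall>x. A (perm_unitary g x) = perm_unitary g (A x))"
    if "i < n" for i n
    using trans[OF that] by (metis blinfun_apply_blinfun_compose)
  have A_Some: "A (?e i) = c *\<^sub>c ?e i" for i
  proof -
    \<comment> \<open>The unitary commutes with A and with scalars, so it carries the error vector
      at i to the one at n without changing its norm.\<close>
    have "norm (A (?e n) - c *\<^sub>c ?e n) = norm (A (?e i) - c *\<^sub>c ?e i)" if "i < n" for n
    proof -
      obtain g where g: "bij g" "g i = n" "\<And>x. A (perm_unitary g x) = perm_unitary g (A x)"
        using comm \<open>i < n\<close> by blast
      then have "A (?e n) - c *\<^sub>c ?e n = perm_unitary g (A (?e i) - c *\<^sub>c ?e i)"
        by (metis perm_unitary_basis_vec(2) perm_unitary_cscale blinfun.diff_right)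
      with g show ?thesis
        by (simp add: norm_perm_unitary)
    qed
    \<comment> \<open>An eventually constant function has its constant value as limit, while
      asymptotic scalarity makes the limit 0; hence the error at i vanishes.\<close>
    then have "((\<lambda>n. norm (A (?e n) - c *\<^sub>c ?e n)) \<longlongrightarrow> norm (A (?e i) - c *\<^sub>c ?e i)) at_top"
      by (intro tendsto_eventually eventually_mono[OF eventually_gt_at_top[of i]])
    from tendsto_unique[OF trivial_limit_at_top_linorder this
        tendsto_norm_zero[OF c[unfolded asymptotic_to_def]]]
    show ?thesis by simp
  qed
  have coord_0: "coord (A vacuum) (Some i) = 0" for i
  proof -
    have "coord (A vacuum) (Some n) = coord (A vacuum) (Some i)" if "i < n" for n
    proof -
      obtain g where g: "bij g" "g i = n" "\<And>x. A (perm_unitary g x) = perm_unitary g (A x)"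
        using comm \<open>i < n\<close> by blast
      then have "A vacuum = perm_unitary g (A vacuum)"
        by (metis perm_unitary_basis_vec(1))
      then have "coord (A vacuum) (Some n) = coord (perm_unitary g (A vacuum)) (Some n)"
        by (rule arg_cong)
      also have "\<dots> = coord (A vacuum) (Some i)"
        using g by (auto simp: perm_unitary.rep_eq coord_perm_vec bij_is_inj inv_f_f)
      finally show ?thesis .
    qed
    then have "((\<lambda>n. coord (A vacuum) (Some n)) \<longlongrightarrow> coord (A vacuum) (Some i)) at_top"
      by (intro tendsto_eventually eventually_mono[OF eventually_gt_at_top[of i]])
    moreover have "((\<lambda>n. coord (A vacuum) (Some n)) \<longlongrightarrow> 0) at_top"
    proof -
      \<comment> \<open>Subtracting c' e_n costs nothing because e_n is orthogonal to the vacuum; it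
        produces the vector known to tend to 0.\<close>
      have eq: "coord (A vacuum) (Some n) = cnj (cinner (adj A (?e n) - c' *\<^sub>c ?e n) vacuum)" for n
        using cinner_adj[OF ops, of vacuum "?e n"] by simp
      show ?thesis
        unfolding eq using c'[unfolded asymptotic_to_def]
        by (intro bounded_linear.tendsto_zero[OF bounded_linear_cnj]
            bounded_linear.tendsto_zero[OF bounded_linear_cinner_left])
    qed
    ultimately show ?thesis
      using tendsto_unique[OF trivial_limit_at_top_linorder] by blast
  qed
  have "A = diagonal_op (coord (A vacuum) None) c"
  proof (rule bounded_ops_eqI[OF ops diagonal_op_bounded])
    fix j :: "int option"
    show "A (basis_vec j) = diagonal_op (coord (A vacuum) None) c (basis_vec j)"
    proof (cases j)
      case None
      have "coord (A vacuum) k = coord (diagonal_op (coord (A vacuum) None) c vacuum) k" for k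
        by (cases k) (simp_all add: coord_diagonal_op coord_0)
      then show ?thesis unfolding None by (rule ell2_eqI)
    next
      case (Some i)
      then show ?thesis by (auto intro!: ell2_eqI simp: coord_diagonal_op A_Some)
    qed
  qed
  then show ?thesis by blast
qed

section \<open>The two fixed point algebras\<close>

lemma bij_shift: "bij (\<lambda>i::int. i + k)"
  by (rule bij_betw_byWitness[where f' = "\<lambda>i. i - k"]) auto

lemma perm_unitary_compose:
  assumes "bij g" "bij h"
  shows "perm_unitary (g \<circ> h) = perm_unitary g o\<^sub>L perm_unitary h"
  by (rule blinfun_eqI, rule ell2_eqI)
    (use assms in \<open>simp add: perm_unitary.rep_eq coord_perm_vec bij_comp o_inv_distrib
      option.map_comp\<close>)

lemma fixed_shift_eq: "fixed_shift = {diagonal_op d c | d c. True}"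
proof (intro equalityI subsetI)
  fix A assume "A \<in> fixed_shift"
  then have A: "A \<in> boolean_cstar_algebra"
    and 1: "perm_unitary (\<lambda>i. i + 1) o\<^sub>L A = A o\<^sub>L perm_unitary (\<lambda>i. i + 1)"
    by (simp_all add: fixed_shift_def shift_automorphism_def perm_automorphism_fixed_iff[OF bij_shift])
  \<comment> \<open>Induction over the positive powers of the shift; with \<open>Suc k\<close> as
    exponent the base case is the shift itself.\<close>
  have pow: "perm_unitary (\<lambda>i. i + int (Suc k)) o\<^sub>L A = A o\<^sub>L perm_unitary (\<lambda>i. i + int (Suc k))" for k
  proof (induction k)
    case 0
    then show ?case using 1 by simp
  next
    case (Suc k)
    have "(\<lambda>i. i + int (Suc (Suc k))) = (\<lambda>i. i + 1) \<circ> (\<lambda>i. i + int (Suc k))"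
      by auto
    then have "perm_unitary (\<lambda>i. i + int (Suc (Suc k)))
        = perm_unitary (\<lambda>i. i + 1) o\<^sub>L perm_unitary (\<lambda>i. i + int (Suc k))"
      by (metis bij_shift perm_unitary_compose)
    with Suc 1 show ?case
      by (auto intro!: blinfun_eqI dest!: arg_cong[of _ _ blinfun_apply] simp: fun_eq_iff)
  qed
  have "\<exists>g. bij g \<and> g i = n \<and> perm_unitary g o\<^sub>L A = A o\<^sub>L perm_unitary g" if "i < n" for i n
  proof -
    \<comment> \<open>The subtracted 1 offsets the \<open>Suc\<close>, and i < n keeps the argument
      of \<open>nat\<close> nonnegative.\<close>
    have "i + int (Suc (nat (n - i - 1))) = n"
      using that by simp
    with pow[of "nat (n - i - 1)"] bij_shift show ?thesis
      by (intro exI[of _ "\<lambda>j. j + int (Suc (nat (n - i - 1)))"] conjI)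
  qed
  from fixed_imp_diagonal_op[OF A this] show "A \<in> {diagonal_op d c | d c. True}"
    by blast
qed (auto simp: fixed_shift_def shift_automorphism_def diagonal_op_in_boolean
    perm_automorphism_diagonal_op[OF bij_shift])

lemma fixed_permutations_eq: "fixed_permutations = {diagonal_op d c | d c. True}"
proof (intro equalityI subsetI)
  fix A assume "A \<in> fixed_permutations"
  then have A: "A \<in> boolean_cstar_algebra"
    and fixed: "\<And>g. bij g \<Longrightarrow> finite {i. g i \<noteq> i} \<Longrightarrow> perm_automorphism g A = A"
    by (auto simp: fixed_permutations_def)
  have "\<exists>g. bij g \<and> g i = n \<and> perm_unitary g o\<^sub>L A = A o\<^sub>L perm_unitary g" for i n
  \<comment> \<open>Transpositions move at most two points, so they are finitary and already move
    any index to any other.\<close>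
  proof (intro exI[of _ "Transposition.transpose i n"] conjI)
    have "finite {k. Transposition.transpose i n k \<noteq> k}"
      by (rule finite_subset[of _ "{i, n}"]) (auto simp: Transposition.transpose_def)
    then show "perm_unitary (Transposition.transpose i n) o\<^sub>L A
        = A o\<^sub>L perm_unitary (Transposition.transpose i n)"
      using fixed perm_automorphism_fixed_iff by (metis bij_transpose)
  qed auto
  from fixed_imp_diagonal_op[OF A this] show "A \<in> {diagonal_op d c | d c. True}"
    by blast
qed (auto simp: fixed_permutations_def diagonal_op_in_boolean perm_automorphism_diagonal_op)

section \<open>Direct sum decomposition and the vacuum projection\<close>

lemma algebra_direct_sum_diagonal_op:
  "algebra_direct_sum {diagonal_op d c | d c. True}
    (cline vacuum_projection) (cline (id_blinfun - vacuum_projection))"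
  unfolding algebra_direct_sum_def
proof (intro conjI ballI)
  show "{diagonal_op d c | d c. True} =
      {A + B | A B. A \<in> cline vacuum_projection \<and> B \<in> cline (id_blinfun - vacuum_projection)}"
    by (auto simp: diagonal_op_def cline_def)
  have "A = 0" if A: "A \<in> cline vacuum_projection" "A \<in> cline (id_blinfun - vacuum_projection)" for A
  proof -
    obtain c d where c: "A = c *\<^sub>o vacuum_projection" and d: "A = d *\<^sub>o (id_blinfun - vacuum_projection)"
      using A unfolding cline_def by blast
    \<comment> \<open>The vacuum matrix entry separates the two lines: it reads off the coefficient
      on the first and vanishes on the second.\<close>
    have "c = coord (A vacuum) None"
      by (simp add: c op_scale_apply vacuum_projection.rep_eq)
    also have "\<dots> = 0"
      by (simp add: d op_scale_apply vacuum_projection.rep_eq blinfun.diff_left)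
    finally show ?thesis
      by (auto intro!: blinfun_eqI ell2_eqI simp: c op_scale_apply)
  qed
  moreover have "0 \<in> cline A" for A :: "int option op"
    unfolding cline_def
    by (rule range_eqI[of _ _ 0]) (auto intro!: blinfun_eqI ell2_eqI simp: op_scale_apply)
  ultimately show "cline vacuum_projection \<inter> cline (id_blinfun - vacuum_projection) = {0}"
    by blast
next
  fix A B assume "A \<in> cline vacuum_projection" "B \<in> cline (id_blinfun - vacuum_projection)"
  then show "A o\<^sub>L B = 0" "B o\<^sub>L A = 0"
    by (auto simp: cline_def op_scale_apply vacuum_projection.rep_eq blinfun.diff_left
        intro!: blinfun_eqI ell2_eqI)
qed

lemma vacuum_projection_orthogonal:
  "orthogonal_projection_onto vacuum_projection (cspan {vacuum})"
proof -
  interpret vector_space "(*\<^sub>c) :: complex \<Rightarrow> int option ell2 \<Rightarrow> _"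
    by (rule vector_space_cscale)
  show ?thesis
    by (auto simp: orthogonal_projection_onto_def vacuum_projection_bounded span_singleton
        vacuum_projection.rep_eq cinner_cscale_right)
qed

theorem proposition7p1:
  shows "orthogonal_projection_onto vacuum_projection (cspan {vacuum})
    \<and> (\<forall>i. annihilation i o\<^sub>L creation i = vacuum_projection)
    \<and> fixed_permutations = fixed_shift
    \<and> algebra_direct_sum fixed_shift
        (cline vacuum_projection) (cline (id_blinfun - vacuum_projection))"
  using vacuum_projection_orthogonal annihilation_creation algebra_direct_sum_diagonal_op
  by (simp add: fixed_permutations_eq fixed_shift_eq)

end
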